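(* The class of $(\overline{P_1+P_3},\,K_{1,3}+3P_1)$-free graphs has bounded clique-width.
   Context: All graphs are finite, simple and undirected. For a family of graphs $\{H_1,\ldots,H_p\}$, a graph $G$ is $(H_1,\ldots,H_p)$-free if no induced subgraph of $G$ is isomorphic to any $H_i$. $P_r$ denotes the path on $r$ vertices, $K_{1,3}$ the claw (star with three leaves); $G+H$ is the disjoint union of $G$ and $H$, $sG$ is the disjoint union of $s$ copies of $G$; $\overline{G}$ denotes the complement of $G$. The clique-width of a graph $G$ is the minimum number of labels needed to construct $G$ using the operations: create a single vertex with label $i$; take the disjoint union of two labelled graphs; add all edges between vertices labelled $i$ and vertices labelled $j$ ($i\neq j$); rename label $i$ to $j$. A class of graphs has bounded clique-width if there is a constant $c$ such that every graph in the class has clique-width at most $c$. *)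

theory Defs
  imports
    "Graph_Theory.Digraph_Component"
    "Graph_Theory.Digraph_Isomorphism"
begin

text \<open>
  A finite, simple, undirected graph is a \<^typ>\<open>'a pair_pre_digraph\<close> satisfying the library locale
  predicate \<^const>\<open>pair_graph\<close>: the arc relation is finite, irreflexive and symmetric, and an
  undirected edge \<open>uv\<close> is the pair of arcs \<open>(u, v)\<close>, \<open>(v, u)\<close>.
\<close>

section \<open>Graphs and graph operations\<close>

definition path_graph :: "nat \<Rightarrow> nat pair_pre_digraph" where
  "path_graph r =
     \<lparr> pverts = {..<r},
       parcs = {(u, v). u < r \<and> v < r \<and> (v = Suc u \<or> u = Suc v)} \<rparr>"

definition star_graph :: "nat \<Rightarrow> nat pair_pre_digraph" where
  "star_graph s =
     \<lparr> pverts = {..s},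
       parcs = {(u, v). u \<le> s \<and> v \<le> s \<and> u \<noteq> v \<and> (u = 0 \<or> v = 0)} \<rparr>"

definition claw :: "nat pair_pre_digraph" where
  "claw = star_graph 3"

definition disj_union ::
  "'a pair_pre_digraph \<Rightarrow> 'b pair_pre_digraph \<Rightarrow> ('a + 'b) pair_pre_digraph" where
  "disj_union G H =
     \<lparr> pverts = pverts G <+> pverts H,
       parcs = {(Inl u, Inl v) | u v. (u, v) \<in> parcs G} \<union> {(Inr u, Inr v) | u v. (u, v) \<in> parcs H} \<rparr>"

definition copies :: "nat \<Rightarrow> 'a pair_pre_digraph \<Rightarrow> (nat \<times> 'a) pair_pre_digraph" where
  "copies s G =
     \<lparr> pverts = {..<s} \<times> pverts G,
       parcs = {((i, u), (i, v)) | i u v. i < s \<and> (u, v) \<in> parcs G} \<rparr>"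

definition graph_compl :: "'a pair_pre_digraph \<Rightarrow> 'a pair_pre_digraph" where
  "graph_compl G =
     \<lparr> pverts = pverts G,
       parcs = {(u, v). u \<in> pverts G \<and> v \<in> pverts G \<and> u \<noteq> v \<and> (u, v) \<notin> parcs G} \<rparr>"

lemma pair_graph_iff:
  "pair_graph G \<longleftrightarrow>
     finite (pverts G) \<and> parcs G \<subseteq> pverts G \<times> pverts G \<and>
     (\<forall>u v. (u, v) \<in> parcs G \<longrightarrow> u \<noteq> v \<and> (v, u) \<in> parcs G)"
proof
  assume "pair_graph G"
  then interpret pair_graph G .
  show "finite (pverts G) \<and> parcs G \<subseteq> pverts G \<times> pverts G \<and>
     (\<forall>u v. (u, v) \<in> parcs G \<longrightarrow> u \<noteq> v \<and> (v, u) \<in> parcs G)"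
    using pair_finite_verts pair_sym_arcs in_arcsD1 in_arcsD2 pair_no_loops
    by (fastforce simp: symmetric_def sym_def)
next
  assume a: "finite (pverts G) \<and> parcs G \<subseteq> pverts G \<times> pverts G \<and>
     (\<forall>u v. (u, v) \<in> parcs G \<longrightarrow> u \<noteq> v \<and> (v, u) \<in> parcs G)"
  then have "finite (parcs G)"
    by (meson finite_SigmaI finite_subset)
  with a show "pair_graph G"
    by unfold_locales (auto simp: symmetric_def sym_def)
qed

lemma pair_graph_path_graph: "pair_graph (path_graph r)"
  by (auto simp: pair_graph_iff path_graph_def)

lemma pair_graph_claw: "pair_graph claw"
  by (auto simp: pair_graph_iff claw_def star_graph_def)

lemma pair_graph_disj_union:
  "pair_graph G \<Longrightarrow> pair_graph H \<Longrightarrow> pair_graph (disj_union G H)"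
  by (auto simp: pair_graph_iff disj_union_def)

lemma pair_graph_copies: "pair_graph G \<Longrightarrow> pair_graph (copies s G)"
  by (auto simp: pair_graph_iff copies_def)

lemma pair_graph_graph_compl: "pair_graph G \<Longrightarrow> pair_graph (graph_compl G)"
  by (auto simp: pair_graph_iff graph_compl_def)


section \<open>Forbidden induced subgraphs\<close>

definition induced_free :: "'b pair_pre_digraph \<Rightarrow> 'a pair_pre_digraph \<Rightarrow> bool" where
  "induced_free H G \<longleftrightarrow>
     \<not> (\<exists>K. induced_subgraph K (with_proj G) \<and> digraph_iso K (with_proj H))"


section \<open>Clique-width\<close>

text \<open>
  \<open>cw_construct k G lab\<close>: the labelled graph \<open>(G, lab)\<close> can be built with labels \<open>0, \<dots>, k - 1\<close>.
  The vertices are given their final names when they are created, so disjoint union applies to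
  graphs with disjoint vertex sets. Values of \<open>lab\<close> outside \<open>pverts G\<close> are irrelevant.
\<close>

inductive cw_construct :: "nat \<Rightarrow> 'a pair_pre_digraph \<Rightarrow> ('a \<Rightarrow> nat) \<Rightarrow> bool"
  for k :: nat where
  create:
    "i < k \<Longrightarrow> cw_construct k \<lparr> pverts = {v}, parcs = {} \<rparr> (\<lambda>_. i)"
| union:
    "cw_construct k G lab \<Longrightarrow> cw_construct k H lab' \<Longrightarrow> pverts G \<inter> pverts H = {} \<Longrightarrow>
     cw_construct k \<lparr> pverts = pverts G \<union> pverts H, parcs = parcs G \<union> parcs H \<rparr>
       (\<lambda>v. if v \<in> pverts G then lab v else lab' v)"
| join:
    "cw_construct k G lab \<Longrightarrow> i < k \<Longrightarrow> j < k \<Longrightarrow> i \<noteq> j \<Longrightarrow>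
     cw_construct k
       \<lparr> pverts = pverts G,
         parcs = parcs G \<union> {(u, v). u \<in> pverts G \<and> v \<in> pverts G \<and>
           (lab u = i \<and> lab v = j \<or> lab u = j \<and> lab v = i)} \<rparr> lab"
| relabel:
    "cw_construct k G lab \<Longrightarrow> i < k \<Longrightarrow> j < k \<Longrightarrow>
     cw_construct k G (\<lambda>v. if lab v = i then j else lab v)"

text \<open>
  The graph without vertices admits no construction; as \<open>Inf {} = 0\<close> on the natural
  numbers, its clique-width is 0. For every other finite simple graph the infimum is a minimum, see
  \<open>clique_width_attained\<close> below.
\<close>

definition clique_width :: "'a pair_pre_digraph \<Rightarrow> nat" where
  "clique_width G = Inf {k. \<exists>lab. cw_construct k G lab}"

definition bounded_clique_width :: "'a pair_pre_digraph set \<Rightarrow> bool" where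
  "bounded_clique_width \<G> \<longleftrightarrow> (\<exists>c. \<forall>G \<in> \<G>. clique_width G \<le> c)"

lemma cw_construct_edgeless:
  assumes "finite V" "V \<noteq> {}" "\<forall>v \<in> V. l v < k"
  shows "\<exists>lab. (\<forall>v \<in> V. lab v = l v) \<and> cw_construct k \<lparr> pverts = V, parcs = {} \<rparr> lab"
  using assms
proof (induction V rule: finite_ne_induct)
  case (singleton x)
  then show ?case using create[of "l x" k x] by auto
next
  case (insert x V)
  then obtain lab where lab: "\<forall>v \<in> V. lab v = l v" "cw_construct k \<lparr> pverts = V, parcs = {} \<rparr> lab"
    by auto
  have "cw_construct k \<lparr> pverts = {x}, parcs = {} \<rparr> (\<lambda>_. l x)"
    using insert.prems by (auto intro: create)
  from union[OF this lab(2)] insert.hyps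
  have "cw_construct k \<lparr> pverts = insert x V, parcs = {} \<rparr> (\<lambda>v. if v = x then l x else lab v)"
    by simp
  with lab(1) show ?case by (intro exI conjI) auto
qed

lemma cw_construct_add_edges:
  assumes "finite F" "F \<subseteq> V \<times> V" "\<forall>(u, v) \<in> F. u \<noteq> v" "inj_on lab V" "\<forall>v \<in> V. lab v < k"
    and "cw_construct k \<lparr> pverts = V, parcs = {} \<rparr> lab"
  shows "cw_construct k \<lparr> pverts = V, parcs = F \<union> F\<inverse> \<rparr> lab"
  using assms
proof (induction F rule: finite_induct)
  case empty
  then show ?case by simp
next
  case (insert e F)
  obtain x y where e: "e = (x, y)" by force
  have xy: "x \<in> V" "y \<in> V" "x \<noteq> y" using insert.prems e by auto
  have "cw_construct k \<lparr> pverts = V, parcs = F \<union> F\<inverse> \<rparr> lab"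
    using insert by auto
  from join[OF this, of "lab x" "lab y"]
  have *: "cw_construct k \<lparr> pverts = V, parcs = F \<union> F\<inverse> \<union> {(u, v). u \<in> V \<and> v \<in> V \<and>
      (lab u = lab x \<and> lab v = lab y \<or> lab u = lab y \<and> lab v = lab x)} \<rparr> lab"
    using xy insert.prems by (simp add: inj_on_eq_iff)
  have "{(u, v). u \<in> V \<and> v \<in> V \<and>
      (lab u = lab x \<and> lab v = lab y \<or> lab u = lab y \<and> lab v = lab x)} = {(x, y), (y, x)}"
    using xy insert.prems(3) by (auto simp: inj_on_eq_iff)
  with * have "cw_construct k \<lparr> pverts = V, parcs = F \<union> F\<inverse> \<union> {(x, y), (y, x)} \<rparr> lab"
    by simp
  moreover have "F \<union> F\<inverse> \<union> {(x, y), (y, x)} = insert e F \<union> (insert e F)\<inverse>"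
    using e by auto
  ultimately show ?case by simp
qed

lemma clique_width_attained:
  assumes "pair_graph G" "pverts G \<noteq> {}"
  shows "\<exists>lab. cw_construct (clique_width G) G lab"
proof -
  have fin: "finite (pverts G)" and arcs: "parcs G \<subseteq> pverts G \<times> pverts G"
    and edges: "\<forall>u v. (u, v) \<in> parcs G \<longrightarrow> u \<noteq> v \<and> (v, u) \<in> parcs G"
    using assms(1) by (auto simp: pair_graph_iff)
  define n where "n = card (pverts G)"
  from fin obtain l where l: "bij_betw l (pverts G) {0..<n}"
    unfolding n_def using ex_bij_betw_finite_nat by blast
  then have l_less: "\<forall>v \<in> pverts G. l v < n"
    by (auto simp: bij_betw_def)
  from cw_construct_edgeless[OF fin assms(2) l_less] obtain lab where
    lab: "\<forall>v \<in> pverts G. lab v = l v" "cw_construct n \<lparr> pverts = pverts G, parcs = {} \<rparr> lab"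
    by blast
  have inj: "inj_on lab (pverts G)"
    using l lab(1) by (metis bij_betw_def inj_on_cong)
  have "finite (parcs G)" using arcs fin by (meson finite_SigmaI finite_subset)
  then have "cw_construct n \<lparr> pverts = pverts G, parcs = parcs G \<union> (parcs G)\<inverse> \<rparr> lab"
    using arcs edges inj l_less lab by (intro cw_construct_add_edges) auto
  moreover have "parcs G \<union> (parcs G)\<inverse> = parcs G" using edges by auto
  moreover have "\<lparr> pverts = pverts G, parcs = parcs G \<rparr> = G" by simp
  ultimately have "n \<in> {k. \<exists>lab. cw_construct k G lab}" by auto
  then have "Inf {k. \<exists>lab. cw_construct k G lab} \<in> {k. \<exists>lab. cw_construct k G lab}"
    by (intro Inf_nat_def1) blast
  then show ?thesis unfolding clique_width_def by blast
qed

end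

theory Submission
  imports Defs
begin

text \<open>
  The complement of \<open>P\<^sub>1 + P\<^sub>3\<close> is the paw. A connected paw-free graph with a triangle is complete
  multipartite (Olariu), so by induction along disjoint unions and joins it remains to treat
  triangle-free graphs. There a claw has at most five common non-neighbours, as \<open>R(3,3) = 6\<close>. Hence
  either the maximum degree is at most 2, or the number of vertices is bounded, or some vertex has
  large degree. In the last case the graph becomes, after the removal of at most 11 vertices,
  bipartite with a bipartite complement of maximum degree at most 2. All three cases are
  flips of a graph of maximum degree at most 2 along a bounded number of vertex types; such a
  graph is built vertex by vertex so that at most two edges of the sparse graph leave the part already
  built.
\<close>

section \<open>Flips of graphs of maximum degree two\<close>

text \<open>The relation stays fixed on the whole type, so only the vertex set varies while a graph
  is built or taken apart.\<close>

definition induce :: "'a rel \<Rightarrow> 'a set \<Rightarrow> 'a pair_pre_digraph" where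
  "induce E X = \<lparr> pverts = X, parcs = E \<inter> X \<times> X \<rparr>"

section \<open>Joins and relabellings for sets of labels, and the addition of a vertex\<close>

lemma cw_construct_joins:
  assumes "finite J" "J \<subseteq> {..<k}" "i < k" "i \<notin> J" "cw_construct k G lab"
  shows "cw_construct k \<lparr> pverts = pverts G, parcs = parcs G \<union> {(u, v). u \<in> pverts G \<and> v \<in> pverts G \<and>
    (lab u = i \<and> lab v \<in> J \<or> lab u \<in> J \<and> lab v = i)} \<rparr> lab"
  using assms
proof (induction J rule: finite_induct)
  case empty
  then show ?case by (cases G) simp
next
  case (insert j J)
  then have "cw_construct k \<lparr> pverts = pverts G, parcs = parcs G \<union> {(u, v). u \<in> pverts G \<and> v \<in> pverts G \<and>
    (lab u = i \<and> lab v \<in> J \<or> lab u \<in> J \<and> lab v = i)} \<rparr> lab" by auto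
  from join[OF this, of i j] insert.prems
  have *: "cw_construct k \<lparr> pverts = pverts G, parcs = parcs G \<union> {(u, v). u \<in> pverts G \<and> v \<in> pverts G \<and>
    (lab u = i \<and> lab v \<in> J \<or> lab u \<in> J \<and> lab v = i)} \<union>
    {(u, v). u \<in> pverts G \<and> v \<in> pverts G \<and> (lab u = i \<and> lab v = j \<or> lab u = j \<and> lab v = i)} \<rparr> lab"
    by auto
  show ?case
    by (rule back_subst[where P="\<lambda>G. cw_construct k G lab", OF *]) auto
qed

text \<open>Since \<open>\<rho>\<close> maps \<open>S\<close> outside \<open>S\<close>, a renamed
  label is never renamed again, so treating the labels of \<open>S\<close> one at a time amounts to
  a simultaneous substitution.\<close>

lemma cw_construct_relabels:
  assumes "finite S" "S \<subseteq> {..<k}" "\<rho> ` S \<subseteq> {..<k} - S" "cw_construct k G lab"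
  shows "cw_construct k G (\<lambda>v. if lab v \<in> S then \<rho> (lab v) else lab v)"
  using assms
proof (induction S rule: finite_induct)
  case empty
  then show ?case by simp
next
  case (insert i S)
  have "cw_construct k G (\<lambda>v. if lab v \<in> S then \<rho> (lab v) else lab v)" (is "cw_construct k G ?l")
    using insert by auto
  from relabel[OF this, of i "\<rho> i"] insert.prems
  have *: "cw_construct k G (\<lambda>v. if ?l v = i then \<rho> i else ?l v)" by auto
  show ?case
    by (rule back_subst[where P="cw_construct k G", OF *])
      (use insert.prems(2) insert.hyps(2) in \<open>auto simp: fun_eq_iff\<close>)
qed

text \<open>As no vertex of \<open>X\<close> carries \<open>i\<close>, joining \<open>i\<close> with
  \<open>J\<close> creates exactly the edges at \<open>w\<close>; a new vertex needs just one label
  that is not in use.\<close>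

lemma cw_construct_add_vertex:
  assumes "sym E" "irrefl E" "w \<notin> X" "cw_construct k (induce E X) lab"
    and "i < k" "\<forall>u \<in> X. lab u \<noteq> i" "J \<subseteq> {..<k}" "i \<notin> J"
    and adj: "\<forall>u \<in> X. (u, w) \<in> E \<longleftrightarrow> lab u \<in> J"
  shows "\<exists>lab'. cw_construct k (induce E (insert w X)) lab' \<and> lab' w = i \<and> (\<forall>u \<in> X. lab' u = lab u)"
proof -
  let ?l = "\<lambda>v. if v \<in> X then lab v else i"
  have "cw_construct k \<lparr> pverts = {w}, parcs = {} \<rparr> (\<lambda>_. i)"
    using \<open>i < k\<close> by (rule create)
  from union[OF assms(4) this] \<open>w \<notin> X\<close>
  have u: "cw_construct k \<lparr> pverts = insert w X, parcs = E \<inter> X \<times> X \<rparr> ?l"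
    by (simp add: induce_def)
  have "finite J" using assms(7) finite_subset by blast
  from cw_construct_joins[OF this assms(7,5,8) u]
  have *: "cw_construct k \<lparr> pverts = insert w X, parcs = E \<inter> X \<times> X \<union>
      {(u, v). u \<in> insert w X \<and> v \<in> insert w X \<and> (?l u = i \<and> ?l v \<in> J \<or> ?l u \<in> J \<and> ?l v = i)} \<rparr> ?l"
    by simp
  have sy: "(w, u) \<in> E \<longleftrightarrow> (u, w) \<in> E" if "u \<noteq> w" for u
    using \<open>sym E\<close> by (auto simp: sym_def)
  have ww: "(w, w) \<notin> E"
    using \<open>irrefl E\<close> by (auto simp: irrefl_def)
  have mem: "(u, v) \<in> E \<inter> X \<times> X \<union>
      {(u, v). u \<in> insert w X \<and> v \<in> insert w X \<and> (?l u = i \<and> ?l v \<in> J \<or> ?l u \<in> J \<and> ?l v = i)}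
    \<longleftrightarrow> (u, v) \<in> E \<inter> insert w X \<times> insert w X" for u v
    using assms(3,6,8) adj sy ww
    by (cases "u = w"; cases "v = w") auto
  have "E \<inter> X \<times> X \<union>
      {(u, v). u \<in> insert w X \<and> v \<in> insert w X \<and> (?l u = i \<and> ?l v \<in> J \<or> ?l u \<in> J \<and> ?l v = i)}
    = E \<inter> insert w X \<times> insert w X"
    by (intro subset_antisym subrelI) (erule mem[THEN iffD1], erule mem[THEN iffD2])
  with * have "cw_construct k (induce E (insert w X)) ?l"
    by (simp add: induce_def)
  then show ?thesis
    using \<open>w \<notin> X\<close> by (intro exI[of _ ?l]) auto
qed

text \<open>
  A vertex of \<open>X\<close> is active if its adjacencies to the vertices outside \<open>X\<close> are not all predicted by the
  types \<open>t\<close>. Inactive vertices carry their type as label, the at most two active ones have private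
  labels among \<open>m, m + 1, m + 2\<close>, which leaves one for the next vertex.
\<close>

definition active :: "'a rel \<Rightarrow> ('a \<Rightarrow> nat) \<Rightarrow> (nat \<Rightarrow> nat \<Rightarrow> bool) \<Rightarrow> 'a set \<Rightarrow> 'a set \<Rightarrow> 'a set" where
  "active E t f V X = {u \<in> X. \<exists>w \<in> V - X. ((u, w) \<in> E) \<noteq> f (t u) (t w)}"

definition boundary_labelling ::
  "nat \<Rightarrow> 'a set \<Rightarrow> 'a set \<Rightarrow> ('a \<Rightarrow> nat) \<Rightarrow> ('a \<Rightarrow> nat) \<Rightarrow> bool" where
  "boundary_labelling m A X t lab \<longleftrightarrow>
     (\<forall>u \<in> X - A. lab u = t u) \<and> lab ` A \<subseteq> {m..<m + 3} \<and> inj_on lab A"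

text \<open>Enlarging \<open>X\<close> only removes outside vertices, so no inactive vertex of
  \<open>X\<close> becomes active. The new vertex enters under a free private label; then every
  vertex with a private label that is not active any more falls back to its type, which frees the
  label.\<close>

lemma boundary_step:
  fixes m :: nat
  assumes "sym E" "irrefl E" "finite V" "X \<subseteq> V" "w \<in> V" "w \<notin> X" "\<forall>u \<in> V. t u < m"
    and cw: "cw_construct (m + 3) (induce E X) lab"
    and lab: "boundary_labelling m (active E t f V X) X t lab"
    and card: "card (active E t f V X) \<le> 2"
  shows "\<exists>lab. cw_construct (m + 3) (induce E (insert w X)) lab \<and>
    boundary_labelling m (active E t f V (insert w X)) (insert w X) t lab"
proof -
  let ?A = "active E t f V X" and ?A' = "active E t f V (insert w X)"
  have AX: "?A \<subseteq> X" by (auto simp: active_def)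
  have A'A: "?A' \<subseteq> insert w ?A" by (auto simp: active_def)
  have finA: "finite ?A" by (rule finite_subset[OF AX finite_subset[OF assms(4,3)]])
  have lab': "\<forall>u \<in> X - ?A. lab u = t u" "lab ` ?A \<subseteq> {m..<m + 3}" and inj: "inj_on lab ?A"
    using lab unfolding boundary_labelling_def by blast+
  have lab_in: "lab u = t u" if "u \<in> X" "u \<notin> ?A" for u
    using lab'(1) that by blast
  have lab_A: "m \<le> lab u" "lab u < m + 3" if "u \<in> ?A" for u
    using imageI[OF that, THEN subsetD[OF lab'(2)]] by simp_all
  have "card (lab ` ?A) \<le> 2" using card card_image_le[OF finA, of lab] by simp
  then have "\<not> {m..<m + 3} \<subseteq> lab ` ?A"
    using card_mono[OF finite_imageI[OF finA], of "{m..<m + 3}" lab] by fastforce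
  then obtain i where i: "m \<le> i" "i < m + 3" "i \<notin> lab ` ?A"
    by (meson atLeastLessThan_iff subsetI)
  \<comment> \<open>An inactive vertex is adjacent to \<open>w\<close> exactly when \<open>f\<close>
    says so, hence whole types are selected; active vertices have distinct labels from
    \<open>m\<close> on and are selected one by one.\<close>
  define J where "J = {\<tau>. \<tau> < m \<and> f \<tau> (t w)} \<union> {lab u | u. u \<in> ?A \<and> (u, w) \<in> E}"
  have iX: "\<forall>u \<in> X. lab u \<noteq> i"
  proof
    fix u assume "u \<in> X"
    show "lab u \<noteq> i"
    proof (cases "u \<in> ?A")
      case True then show ?thesis using i(3) by auto
    next
      case False
      have "t u < m" using \<open>u \<in> X\<close> assms(4,7) by blast
      then show ?thesis using lab_in[OF \<open>u \<in> X\<close> False] i(1) by simp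
    qed
  qed
  have JX: "(u, w) \<in> E \<longleftrightarrow> lab u \<in> J" if "u \<in> X" for u
  proof (cases "u \<in> ?A")
    case True
    then have "\<not> lab u < m" using lab_A by fastforce
    then show ?thesis using True inj by (auto simp: J_def inj_on_eq_iff)
  next
    case False
    have "t u < m" using that assms(4,7) by auto
    then have "lab u \<noteq> lab u'" if "u' \<in> ?A" for u'
      using lab_in[OF \<open>u \<in> X\<close> False] lab_A[OF that] by simp
    moreover have "(u, w) \<in> E \<longleftrightarrow> f (t u) (t w)"
      using False that assms(5,6) by (auto simp: active_def)
    ultimately show ?thesis using lab_in[OF that False] \<open>t u < m\<close> by (auto simp: J_def)
  qed
  have "J \<subseteq> {..<m + 3}" "i \<notin> J"
    using i lab_A by (auto simp: J_def)
  from cw_construct_add_vertex[OF assms(1,2,6) cw i(2) iX this] JX obtain l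
    where l: "cw_construct (m + 3) (induce E (insert w X)) l" "l w = i" "\<forall>u \<in> X. l u = lab u"
    by blast
  have lA: "l u = lab u" if "u \<in> ?A" for u using that AX l(3) by auto
  have injl: "inj_on l (insert w ?A)"
  proof (rule inj_on_insert[THEN iffD2], intro conjI)
    show "inj_on l ?A" using inj inj_on_cong[of ?A l lab] lA by blast
    have "l ` ?A = lab ` ?A" using lA by (rule image_cong[OF refl])
    then show "l w \<notin> l ` (?A - {w})" using i(3) l(2) by blast
  qed
  \<comment> \<open>The private labels to be released once \<open>w\<close> has entered, that of
    \<open>w\<close> included if \<open>w\<close> is inactive; \<open>\<rho>\<close> sends each back
    to the type of its bearer.\<close>
  define S where "S = l ` (insert w ?A - ?A')"
  define \<rho> where "\<rho> = t \<circ> inv_into (insert w ?A) l"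
  have \<rho>: "\<rho> (l u) = t u" if "u \<in> insert w ?A" for u
    using inv_into_f_f[OF injl that] by (simp add: \<rho>_def)
  have l_range: "m \<le> l u" "l u < m + 3" if "u \<in> insert w ?A" for u
    using that i l(2) lA lab_A by auto
  have S: "S \<subseteq> {m..<m + 3}"
    using l_range by (auto simp: S_def)
  have tA: "t u < m" if "u \<in> insert w ?A" for u
    using that AX assms(4,5,7) by auto
  have \<rho>S: "\<rho> ` S \<subseteq> {..<m}"
  proof
    fix y assume "y \<in> \<rho> ` S"
    then obtain u where "u \<in> insert w ?A" "y = \<rho> (l u)" by (auto simp: S_def)
    then show "y \<in> {..<m}" using \<rho> tA by simp
  qed
  let ?l' = "\<lambda>v. if l v \<in> S then \<rho> (l v) else l v"
  have "{..<m} \<subseteq> {..<m + 3} - S" using S by auto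
  with \<rho>S have "\<rho> ` S \<subseteq> {..<m + 3} - S" by blast
  moreover have "S \<subseteq> {..<m + 3}" "finite S" using S finite_subset by auto
  ultimately have cw': "cw_construct (m + 3) (induce E (insert w X)) ?l'"
    using l(1) by (intro cw_construct_relabels) auto
  have notS: "l u \<notin> S" if "u \<in> ?A'" for u
    using that A'A injl by (auto simp: S_def inj_on_def)
  have act: "?l' u = l u" if "u \<in> ?A'" for u using notS[OF that] by simp
  have "boundary_labelling m ?A' (insert w X) t ?l'"
    unfolding boundary_labelling_def
  proof (intro conjI ballI)
    fix u assume u: "u \<in> insert w X - ?A'"
    show "?l' u = t u"
    proof (cases "u \<in> insert w ?A")
      case True
      then have "l u \<in> S" using u by (auto simp: S_def)
      then show ?thesis using \<rho>[OF True] by simp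
    next
      case False
      then have "l u = t u" "t u < m" using u l(3) lab_in assms(4,7) by auto
      then show ?thesis using S by auto
    qed
  next
    show "?l' ` ?A' \<subseteq> {m..<m + 3}"
    proof
      fix y assume "y \<in> ?l' ` ?A'"
      then obtain u where u: "u \<in> ?A'" "y = ?l' u" by blast
      then have "y = l u" using act by simp
      then show "y \<in> {m..<m + 3}" using l_range u A'A by auto
    qed
    have "inj_on l ?A'" using injl A'A by (rule inj_on_subset)
    then show "inj_on ?l' ?A'" by (rule inj_on_cong[THEN iffD1, rotated]) (use act in simp)
  qed
  with cw' show ?thesis by (intro exI conjI)
qed

text \<open>The order of the vertices is chosen on the way: \<open>Q\<close> is an invariant that
  some next vertex preserves and that keeps at most two vertices active, as
  \<open>boundary_step\<close> requires.\<close>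

lemma cw_construct_by_boundary:
  fixes m :: nat
  assumes "sym E" "irrefl E" "finite V" "V \<noteq> {}" "\<forall>u \<in> V. t u < m"
    and "Q {}" "\<And>X. Q X \<Longrightarrow> X \<subset> V \<Longrightarrow> \<exists>w \<in> V - X. Q (insert w X)"
    and "\<And>X. Q X \<Longrightarrow> X \<subseteq> V \<Longrightarrow> card (active E t f V X) \<le> 2"
  shows "\<exists>lab. cw_construct (m + 3) (induce E V) lab"
proof -
  \<comment> \<open>The count starts at one vertex, because the graph without vertices has no
    construction.\<close>
  have "\<exists>X lab. X \<subseteq> V \<and> card X = Suc n \<and> Q X \<and> cw_construct (m + 3) (induce E X) lab \<and>
      boundary_labelling m (active E t f V X) X t lab" if "n < card V" for n
    using that
  proof (induction n)
    case 0
    from assms(4,6,7) obtain w where w: "w \<in> V" "Q {w}" by blast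
    define i where "i = (if w \<in> active E t f V {w} then m else t w)"
    have "i < m + 3" using assms(5) w by (auto simp: i_def)
    then have "cw_construct (m + 3) \<lparr> pverts = {w}, parcs = {} \<rparr> (\<lambda>_. i)" by (rule create)
    moreover have "induce E {w} = \<lparr> pverts = {w}, parcs = {} \<rparr>"
      using assms(2) by (auto simp: induce_def irrefl_def)
    moreover have "boundary_labelling m (active E t f V {w}) {w} t (\<lambda>_. i)"
      by (auto simp: boundary_labelling_def i_def active_def inj_on_def)
    ultimately show ?case using w
      by (intro exI[of _ "{w}"] exI[of _ "\<lambda>_. i"]) auto
  next
    case (Suc n)
    then obtain X lab where X: "X \<subseteq> V" "card X = Suc n" "Q X" "cw_construct (m + 3) (induce E X) lab"
      "boundary_labelling m (active E t f V X) X t lab" by auto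
    then have "X \<subset> V" using Suc.prems by auto
    with assms(7)[OF X(3)] obtain w where w: "w \<in> V" "w \<notin> X" "Q (insert w X)" by auto
    have "card (insert w X) = Suc (Suc n)"
      using X w(2) by (simp add: card.insert_remove card_ge_0_finite)
    moreover from boundary_step[OF assms(1-3) X(1) w(1,2) assms(5) X(4,5) assms(8)[OF X(3,1)]]
    obtain lab where "cw_construct (m + 3) (induce E (insert w X)) lab"
      "boundary_labelling m (active E t f V (insert w X)) (insert w X) t lab" by blast
    ultimately show ?case using w X(1) by blast
  qed
  from this[of "card V - 1"] assms(3,4)
  obtain X lab where X: "X \<subseteq> V" "card X = card V" "cw_construct (m + 3) (induce E X) lab"
    by (auto simp: card_gt_0_iff)
  then have "X = V" using assms(3) card_subset_eq by blast
  with X show ?thesis by blast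
qed

text \<open>
  Adding a vertex with an \<open>H\<close>-neighbour in \<open>X\<close> removes at least one edge from the \<open>H\<close>-cut of \<open>X\<close> and
  adds at most one; if the cut is empty, any vertex may be added.
\<close>

lemma cw_construct_nat_flip:
  fixes m :: nat
  assumes "sym E" "irrefl E" "finite V" "V \<noteq> {}" "\<forall>u \<in> V. t u < m"
    and H: "H \<subseteq> V \<times> V" "sym H" "\<And>u. u \<in> V \<Longrightarrow> card (H `` {u}) \<le> 2"
    and E: "\<And>u v. u \<in> V \<Longrightarrow> v \<in> V \<Longrightarrow> u \<noteq> v \<Longrightarrow> (u, v) \<in> E \<longleftrightarrow> (f (t u) (t v) \<noteq> ((u, v) \<in> H))"
  shows "\<exists>lab. cw_construct (m + 3) (induce E V) lab"
proof (rule cw_construct_by_boundary[OF assms(1-5), where Q="\<lambda>X. card (H \<inter> X \<times> (V - X)) \<le> 2"])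
  have finH: "finite H" using H(1) assms(3) by (meson finite_SigmaI finite_subset)
  fix X
  {
    assume Q: "card (H \<inter> X \<times> (V - X)) \<le> 2" and X: "X \<subset> V"
    show "\<exists>w \<in> V - X. card (H \<inter> insert w X \<times> (V - insert w X)) \<le> 2"
    proof (cases "H \<inter> X \<times> (V - X) = {}")
      case True
      from X obtain w where w: "w \<in> V - X" by blast
      have "H \<inter> insert w X \<times> (V - insert w X) \<subseteq> Pair w ` (H `` {w})"
        using True by blast
      then have "card (H \<inter> insert w X \<times> (V - insert w X)) \<le> card (Pair w ` (H `` {w}))"
        using finH by (intro card_mono) auto
      also have "\<dots> \<le> card (H `` {w})" using finH by (intro card_image_le) auto
      also have "\<dots> \<le> 2" using H(3) w by auto
      finally show ?thesis using w by blast
    next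
      case False
      then obtain u w where uw: "(u, w) \<in> H" "u \<in> X" "w \<in> V - X" by blast
      have wu: "(w, u) \<in> H" using uw(1) H(2) by (auto simp: sym_def)
      have "H \<inter> insert w X \<times> (V - insert w X) \<subseteq>
          (H \<inter> X \<times> (V - X) - {(u, w)}) \<union> Pair w ` (H `` {w} - {u})"
        using uw by blast
      then have "card (H \<inter> insert w X \<times> (V - insert w X)) \<le>
          card ((H \<inter> X \<times> (V - X) - {(u, w)}) \<union> Pair w ` (H `` {w} - {u}))"
        using finH by (intro card_mono) auto
      also have "\<dots> \<le> card (H \<inter> X \<times> (V - X) - {(u, w)}) + card (Pair w ` (H `` {w} - {u}))"
        by (rule card_Un_le)
      also have "card (Pair w ` (H `` {w} - {u})) \<le> card (H `` {w} - {u})"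
        using finH by (intro card_image_le) auto
      also have "card (H `` {w} - {u}) = card (H `` {w}) - 1"
        using wu finH by (intro card_Diff_singleton) auto
      also have "card (H \<inter> X \<times> (V - X) - {(u, w)}) = card (H \<inter> X \<times> (V - X)) - 1"
        using uw by (intro card_Diff_singleton) auto
      finally have "card (H \<inter> insert w X \<times> (V - insert w X)) \<le>
        card (H \<inter> X \<times> (V - X)) - 1 + (card (H `` {w}) - 1)" by simp
      moreover have "card (H `` {w}) \<le> 2" using H(3) uw by auto
      ultimately have "card (H \<inter> insert w X \<times> (V - insert w X)) \<le> 2" using Q by linarith
      then show ?thesis using uw(3) by blast
    qed
  next
    assume Q: "card (H \<inter> X \<times> (V - X)) \<le> 2" and X: "X \<subseteq> V"
    \<comment> \<open>A vertex is active only through a pair mispredicted by \<open>f\<close>, and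
      such a pair is an \<open>H\<close>-edge of the cut.\<close>
    have "active E t f V X \<subseteq> fst ` (H \<inter> X \<times> (V - X))"
    proof
      fix u assume "u \<in> active E t f V X"
      then obtain w where w: "u \<in> X" "w \<in> V - X" "((u, w) \<in> E) \<noteq> f (t u) (t w)"
        by (auto simp: active_def)
      then have "(u, w) \<in> H" using E[of u w] X by auto
      then show "u \<in> fst ` (H \<inter> X \<times> (V - X))" using w by force
    qed
    then have "card (active E t f V X) \<le> card (fst ` (H \<inter> X \<times> (V - X)))"
      using finH by (intro card_mono) auto
    also have "\<dots> \<le> card (H \<inter> X \<times> (V - X))" using finH by (intro card_image_le) auto
    finally show "card (active E t f V X) \<le> 2" using Q by simp
  }
qed simp

text \<open>Numbering the types by a bijection \<open>h\<close> and transporting \<open>f\<close>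
  along its inverse allows types from any finite set, such as vertices or sets of
  neighbours.\<close>

lemma cw_construct_flip:
  assumes "sym E" "irrefl E" "finite V" "V \<noteq> {}" "t ` V \<subseteq> T" "finite T" "card T \<le> m"
    and H: "H \<subseteq> V \<times> V" "sym H" "\<And>u. u \<in> V \<Longrightarrow> card (H `` {u}) \<le> 2"
    and E: "\<And>u v. u \<in> V \<Longrightarrow> v \<in> V \<Longrightarrow> u \<noteq> v \<Longrightarrow> (u, v) \<in> E \<longleftrightarrow> (f (t u) (t v) \<noteq> ((u, v) \<in> H))"
  shows "\<exists>lab. cw_construct (m + 3) (induce E V) lab"
proof -
  from ex_bij_betw_finite_nat[OF \<open>finite T\<close>] obtain h where h: "bij_betw h T {0..<card T}" by blast
  let ?g = "inv_into T h"
  have g: "?g (h (t u)) = t u" if "u \<in> V" for u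
    using h that assms(5) by (intro inv_into_f_f) (auto simp: bij_betw_def)
  show ?thesis
  proof (rule cw_construct_nat_flip[OF assms(1-4) _ H, where t="h \<circ> t" and f="\<lambda>x y. f (?g x) (?g y)"])
    show "\<forall>u \<in> V. (h \<circ> t) u < m"
    proof
      fix u assume "u \<in> V"
      then have "h (t u) \<in> {0..<card T}"
        using bij_betwE[OF h] assms(5) by blast
      then show "(h \<circ> t) u < m" using assms(7) by simp
    qed
  qed (simp_all add: E g)
qed


section \<open>Triangle-free graphs\<close>

definition independent_in :: "'a rel \<Rightarrow> 'a set \<Rightarrow> bool" where
  "independent_in E X \<longleftrightarrow> (\<forall>u \<in> X. \<forall>v \<in> X. (u, v) \<notin> E)"

definition triangle_free_on :: "'a rel \<Rightarrow> 'a set \<Rightarrow> bool" where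
  "triangle_free_on E V \<longleftrightarrow>
     (\<forall>a \<in> V. \<forall>b \<in> V. \<forall>c \<in> V. (a, b) \<in> E \<longrightarrow> (b, c) \<in> E \<longrightarrow> (a, c) \<in> E \<longrightarrow> False)"

definition claw_3P1_free_on :: "'a rel \<Rightarrow> 'a set \<Rightarrow> bool" where
  "claw_3P1_free_on E V \<longleftrightarrow>
     \<not> (\<exists>x T I. x \<in> V \<and> T \<subseteq> V \<and> I \<subseteq> V \<and> card T = 3 \<and> card I = 3 \<and>
        T \<subseteq> E `` {x} \<and> I \<inter> E `` {x} = {} \<and> independent_in E (T \<union> I))"

section \<open>Independent triples and counting\<close>

lemma independent_in_subset: "independent_in E Y \<Longrightarrow> X \<subseteq> Y \<Longrightarrow> independent_in E X"
  by (auto simp: independent_in_def)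

lemma independent_in_neighbours:
  "triangle_free_on E V \<Longrightarrow> x \<in> V \<Longrightarrow> T \<subseteq> V \<Longrightarrow> T \<subseteq> E `` {x} \<Longrightarrow> independent_in E T"
  unfolding triangle_free_on_def independent_in_def by blast

text \<open>The Ramsey argument for R(3,3): among five other vertices, \<open>x\<close> has three
  neighbours, which are independent, or three non-neighbours, two of which are non-adjacent and form
  the triple with \<open>x\<close>.\<close>

lemma independent_triple:
  assumes "sym E" "irrefl E" "triangle_free_on E X" "finite X" "6 \<le> card X"
  shows "\<exists>I \<subseteq> X. card I = 3 \<and> independent_in E I"
proof -
  obtain x where x: "x \<in> X" using assms(5) by fastforce
  let ?N = "(X - {x}) \<inter> E `` {x}" and ?M = "X - {x} - E `` {x}"
  have "card (X - {x}) = card ?N + card ?M"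
    using assms(4) by (subst card_Un_disjoint[symmetric]) (auto intro: arg_cong[where f=card])
  moreover have "card (X - {x}) = card X - 1" using x by simp
  ultimately consider "3 \<le> card ?N" | "3 \<le> card ?M" using assms(5) by linarith
  then show ?thesis
  proof cases
    case 1
    then obtain T where "T \<subseteq> ?N" "card T = 3" by (meson obtain_subset_with_card_n)
    then show ?thesis
      using independent_in_neighbours[OF assms(3) x, of T] by blast
  next
    case 2
    then obtain T where T: "T \<subseteq> ?M" "card T = 3" by (meson obtain_subset_with_card_n)
    then obtain p q r where pqr: "T = {p, q, r}" "p \<noteq> q" "q \<noteq> r" "p \<noteq> r"
      by (auto simp: card_3_iff)
    have "\<not> ((p, q) \<in> E \<and> (q, r) \<in> E \<and> (p, r) \<in> E)"
      using assms(3) T(1) pqr(1) unfolding triangle_free_on_def by blast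
    then obtain y z where yz: "y \<in> T" "z \<in> T" "y \<noteq> z" "(y, z) \<notin> E"
      using pqr by blast
    have "(x, y) \<notin> E" "(x, z) \<notin> E" "x \<noteq> y" "x \<noteq> z" using yz T(1) by auto
    then have "independent_in E {x, y, z}"
      using yz(4) assms(1,2) by (auto simp: independent_in_def sym_def irrefl_def)
    moreover have "card {x, y, z} = 3" using yz(3) \<open>x \<noteq> y\<close> \<open>x \<noteq> z\<close> by simp
    moreover have "{x, y, z} \<subseteq> X" using yz T(1) x by blast
    ultimately show ?thesis by blast
  qed
qed

lemma card_UN_bound:
  assumes "finite I" "\<And>i. i \<in> I \<Longrightarrow> card (F i) \<le> c"
  shows "card (\<Union>i \<in> I. F i) \<le> card I * c"
proof -
  have "card (\<Union>i \<in> I. F i) \<le> (\<Sum>i \<in> I. card (F i))" by (rule card_UN_le[OF assms(1)])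
  also have "\<dots> \<le> card I * c" using sum_bounded_above[OF assms(2)] by simp
  finally show ?thesis .
qed

section \<open>Structure of the triangle-free graphs in the class\<close>

locale triangle_claw_free =
  fixes E :: "'a rel" and V :: "'a set"
  assumes sym: "sym E" and irrefl: "irrefl E" and finite: "finite V"
    and triangle_free: "triangle_free_on E V"
    and claw_free: "claw_3P1_free_on E V"
begin

lemma adj_commute: "(u, v) \<in> E \<longleftrightarrow> (v, u) \<in> E"
  using sym by (auto simp: sym_def)

text \<open>Three vertices of \<open>I\<close> would extend the claw with centre \<open>x\<close>
  and leaves \<open>T\<close> to the forbidden graph.\<close>

lemma independent_far_le_2:
  assumes "x \<in> V" "T \<subseteq> V" "card T = 3" "T \<subseteq> E `` {x}"
    and "I \<subseteq> V" "I \<inter> E `` {x} = {}" "independent_in E (T \<union> I)"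
  shows "card I \<le> 2"
proof (rule ccontr)
  assume "\<not> card I \<le> 2"
  then have "3 \<le> card I" by simp
  then obtain J where J: "J \<subseteq> I" "card J = 3" by (meson obtain_subset_with_card_n)
  have "T \<union> J \<subseteq> T \<union> I" using J(1) by blast
  with assms(7) have "independent_in E (T \<union> J)" by (rule independent_in_subset)
  moreover have "J \<subseteq> V" "J \<inter> E `` {x} = {}" using assms(5,6) J(1) by blast+
  ultimately show False
    using claw_free assms(1-4) J(2) unfolding claw_3P1_free_on_def by blast
qed

lemma far_le_5:
  assumes "x \<in> V" "T \<subseteq> V" "card T = 3" "T \<subseteq> E `` {x}"
    and "R \<subseteq> V" "R \<inter> E `` {x} = {}" "R \<inter> E `` T = {}"
  shows "card R \<le> 5"
proof (rule ccontr)
  assume "\<not> card R \<le> 5"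
  moreover have "triangle_free_on E R"
    using triangle_free assms(5) unfolding triangle_free_on_def by blast
  moreover have "finite R" using assms(5) finite finite_subset by blast
  ultimately obtain I where I: "I \<subseteq> R" "card I = 3" "independent_in E I"
    using independent_triple[OF sym irrefl, of R] by auto
  have "independent_in E T" by (rule independent_in_neighbours[OF triangle_free assms(1,2,4)])
  then have "independent_in E (T \<union> I)"
    using I assms(7) adj_commute unfolding independent_in_def by blast
  then have "card I \<le> 2"
    using independent_far_le_2[OF assms(1-4), of I] I assms(5,6) by blast
  then show False using I(2) by simp
qed

text \<open>Take a claw at \<open>x\<close>: its four vertices have at most \<open>4 * d\<close>
  neighbours in all, and at most five vertices are adjacent to none of the four.\<close>

lemma few_vertices:
  assumes "x \<in> V" "3 \<le> card (E `` {x} \<inter> V)" "\<And>v. v \<in> V \<Longrightarrow> card (E `` {v} \<inter> V) \<le> d"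
  shows "card V \<le> 5 + 4 * d"
proof -
  obtain T where T: "T \<subseteq> E `` {x} \<inter> V" "card T = 3"
    using assms(2) by (meson obtain_subset_with_card_n)
  then have finT: "finite T" using card.infinite by fastforce
  let ?N = "\<Union>u \<in> insert x T. E `` {u} \<inter> V"
  have "card ?N \<le> card (insert x T) * d"
    using finT assms(1,3) T(1) by (intro card_UN_bound) auto
  also have "card (insert x T) \<le> 4" using finT T(2) by (simp add: card_insert_if)
  finally have N: "card ?N \<le> 4 * d" by simp
  have "T \<subseteq> V" "T \<subseteq> E `` {x}" using T(1) by blast+
  then have R: "card (V - ?N) \<le> 5"
    using T(2) by (intro far_le_5[OF assms(1), of T]) auto
  have "card V \<le> card (?N \<union> (V - ?N))" using finite finT by (intro card_mono) auto
  also have "\<dots> \<le> card ?N + card (V - ?N)" by (rule card_Un_le)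
  finally show ?thesis using N R by linarith
qed

text \<open>
  If \<open>v\<close> has large degree, then every vertex outside \<open>A = N(v)\<close> with three neighbours in the
  independent set \<open>A\<close> misses at most two vertices of \<open>A\<close>. Hence, apart from few vertices, the
  graph is bipartite and its bipartite complement has maximum degree at most 2.
\<close>

lemma nearly_complete_bipartite:
  assumes "v \<in> V" "15 \<le> card (E `` {v} \<inter> V)"
  shows "\<exists>S A B. V = S \<union> A \<union> B \<and> S \<inter> A = {} \<and> S \<inter> B = {} \<and> A \<inter> B = {} \<and> card S \<le> 11 \<and>
    independent_in E A \<and> independent_in E B \<and>
    (\<forall>a \<in> A. card (B - E `` {a}) \<le> 2) \<and> (\<forall>b \<in> B. card (A - E `` {b}) \<le> 2)"
proof -
  define A where "A = E `` {v} \<inter> V"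
  have AV: "A \<subseteq> V" and AE: "A \<subseteq> E `` {v}" and finA: "finite A" and cA: "15 \<le> card A"
    using assms(2) finite by (auto simp: A_def)
  have indA: "independent_in E A" by (rule independent_in_neighbours[OF triangle_free assms(1) AV AE])
  define C where "C = {b \<in> V - A. card (E `` {b} \<inter> A) \<le> 2}"
  define B where "B = V - A - C"
  have finB: "finite B" using finite by (simp add: B_def)
  \<comment> \<open>Six vertices of \<open>C\<close> have at most 12 neighbours in \<open>A\<close>,
    so three of the at least 15 vertices of \<open>A\<close> remain; with \<open>v\<close> they form
    a claw that the six vertices are all far from.\<close>
  have C5: "card C \<le> 5"
  proof (rule ccontr)
    assume "\<not> card C \<le> 5"
    then have "6 \<le> card C" by simp
    then obtain K where K: "K \<subseteq> C" "card K = 6" by (meson obtain_subset_with_card_n)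
    then have finK: "finite K" using card.infinite by fastforce
    let ?N = "\<Union>b \<in> K. E `` {b} \<inter> A"
    have "card ?N \<le> card K * 2"
      using K(1) finK by (intro card_UN_bound) (auto simp: C_def)
    then have "card A - card ?N \<ge> 3" using cA K(2) by linarith
    moreover have "card A - card ?N \<le> card (A - ?N)" using finK finA by (intro diff_card_le_card_Diff) auto
    ultimately have "3 \<le> card (A - ?N)" by linarith
    then obtain T where T: "T \<subseteq> A - ?N" "card T = 3" by (meson obtain_subset_with_card_n)
    have "T \<subseteq> V" "T \<subseteq> E `` {v}" using T(1) AV AE by blast+
    moreover have "K \<subseteq> V" "K \<inter> E `` {v} = {}" using K(1) by (auto simp: C_def A_def)
    moreover have "K \<inter> E `` T = {}" using T(1) adj_commute by blast
    ultimately have "card K \<le> 5" using T(2) by (intro far_le_5[OF assms(1), of T])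
    then show False using K(2) by simp
  qed
  have B_miss: "card (A - E `` {b}) \<le> 2" if "b \<in> B" for b
  proof -
    have b: "b \<in> V" "3 \<le> card (E `` {b} \<inter> A)" using that by (auto simp: B_def C_def)
    then obtain T where T: "T \<subseteq> E `` {b} \<inter> A" "card T = 3" by (meson obtain_subset_with_card_n)
    show ?thesis
    proof (rule independent_far_le_2[OF b(1) _ T(2)])
      show "independent_in E (T \<union> (A - E `` {b}))"
        by (rule independent_in_subset[OF indA]) (use T(1) in blast)
    qed (use T(1) AV in blast)+
  qed
  \<comment> \<open>Two vertices of \<open>B\<close> together miss at most four vertices of
    \<open>A\<close>, so they have a common neighbour there and an edge between them would close a
    triangle.\<close>
  have indB: "independent_in E B"
    unfolding independent_in_def
  proof (intro ballI notI)
    fix b c assume bc: "b \<in> B" "c \<in> B" "(b, c) \<in> E"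
    have "card ((A - E `` {b}) \<union> (A - E `` {c})) \<le> card (A - E `` {b}) + card (A - E `` {c})"
      by (rule card_Un_le)
    also have "\<dots> < card A" using B_miss[OF bc(1)] B_miss[OF bc(2)] cA by linarith
    finally have "(A - E `` {b}) \<union> (A - E `` {c}) \<noteq> A" by force
    then obtain a where a: "a \<in> A" "(b, a) \<in> E" "(c, a) \<in> E" by blast
    have "b \<in> V" "c \<in> V" "a \<in> V" using bc a AV by (auto simp: B_def)
    then show False using triangle_free a bc(3) unfolding triangle_free_on_def by blast
  qed
  \<comment> \<open>Outside \<open>D\<close> the argument of \<open>B_miss\<close> works with the
    sides exchanged, since \<open>B\<close> is independent as well.\<close>
  define D where "D = {a \<in> A. card (E `` {a} \<inter> B) \<le> 2}"
  have A_miss: "card (B - E `` {a}) \<le> 2" if "a \<in> A - D" for a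
  proof -
    have a: "a \<in> V" "3 \<le> card (E `` {a} \<inter> B)" using that AV by (auto simp: D_def)
    then obtain T where T: "T \<subseteq> E `` {a} \<inter> B" "card T = 3" by (meson obtain_subset_with_card_n)
    show ?thesis
    proof (rule independent_far_le_2[OF a(1) _ T(2)])
      show "independent_in E (T \<union> (B - E `` {a}))"
        by (rule independent_in_subset[OF indB]) (use T(1) in blast)
    qed (use T(1) in \<open>auto simp: B_def\<close>)
  qed
  show ?thesis
  \<comment> \<open>A small \<open>B\<close> is moved entirely to the exceptional set, which then
    has at most 5 + 6 = 11 vertices.\<close>
  proof (cases "card B \<le> 6")
    case True
    have "card (C \<union> B) \<le> 11" using card_Un_le[of C B] C5 True by linarith
    moreover have "V = (C \<union> B) \<union> A \<union> {}" "(C \<union> B) \<inter> A = {}"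
      using AV by (auto simp: B_def C_def)
    ultimately show ?thesis
      using indA by (intro exI[of _ "C \<union> B"] exI[of _ A] exI[of _ "{}"]) (auto simp: independent_in_def)
  next
    case False
    \<comment> \<open>Three vertices of \<open>D\<close> have at most six neighbours in
      \<open>B\<close>, so some vertex of \<open>B\<close> would miss all three, against
      \<open>B_miss\<close>.\<close>
    have D2: "card D \<le> 2"
    proof (rule ccontr)
      assume "\<not> card D \<le> 2"
      then have "3 \<le> card D" by simp
      then obtain T where T: "T \<subseteq> D" "card T = 3" by (meson obtain_subset_with_card_n)
      then have finT: "finite T" using card.infinite by fastforce
      have "card (\<Union>a \<in> T. E `` {a} \<inter> B) \<le> card T * 2"
        using T(1) finT by (intro card_UN_bound) (auto simp: D_def)
      then have "(\<Union>a \<in> T. E `` {a} \<inter> B) \<noteq> B" using False T(2) by auto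
      then obtain b where b: "b \<in> B" "\<forall>a \<in> T. (a, b) \<notin> E" by blast
      then have "T \<subseteq> A - E `` {b}" using T(1) adj_commute by (auto simp: D_def)
      then have "card T \<le> card (A - E `` {b})" using finA by (intro card_mono) auto
      then show False using B_miss[OF b(1)] T(2) by linarith
    qed
    have "card (C \<union> D) \<le> 11" using card_Un_le[of C D] C5 D2 by linarith
    moreover have "V = (C \<union> D) \<union> (A - D) \<union> B" "(C \<union> D) \<inter> (A - D) = {}" "(C \<union> D) \<inter> B = {}" "(A - D) \<inter> B = {}"
      using AV by (auto simp: B_def C_def D_def)
    moreover have "independent_in E (A - D)" using indA by (rule independent_in_subset) blast
    moreover have "card (A - D - E `` {b}) \<le> 2" if "b \<in> B" for b
    proof -
      have "card (A - D - E `` {b}) \<le> card (A - E `` {b})" using finA by (intro card_mono) auto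
      then show ?thesis using B_miss[OF that] by linarith
    qed
    ultimately show ?thesis
      using indB A_miss
      by (intro exI[of _ "C \<union> D"] exI[of _ "A - D"] exI[of _ B] conjI ballI) assumption+
  qed
qed

end

text \<open>Each vertex of \<open>S\<close> is its own type; any other vertex is typed by its side
  and its neighbourhood in \<open>S\<close>, giving \<open>card S + 2 * 2 ^ card S\<close> types.
  The prediction \<open>f\<close> is exact on pairs meeting \<open>S\<close> and inside each side,
  and takes \<open>A\<close> and \<open>B\<close> as completely joined, so it fails exactly on the
  non-edges between them, collected in \<open>H\<close>.\<close>

lemma cw_construct_nearly_complete_bipartite:
  assumes "sym E" "irrefl E" "finite V" "V \<noteq> {}"
    and V: "V = S \<union> A \<union> B" "S \<inter> A = {}" "S \<inter> B = {}" "A \<inter> B = {}"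
    and "independent_in E A" "independent_in E B"
    and A: "\<forall>a \<in> A. card (B - E `` {a}) \<le> 2" and B: "\<forall>b \<in> B. card (A - E `` {b}) \<le> 2"
    and m: "card S + 2 * 2 ^ card S \<le> m"
  shows "\<exists>lab. cw_construct (m + 3) (induce E V) lab"
proof -
  define t where "t v = (if v \<in> S then Inl v else Inr (v \<in> A, E `` {v} \<inter> S))" for v
  define f where "f \<tau> \<sigma> = (case \<tau> of
      Inl s \<Rightarrow> (case \<sigma> of Inl s' \<Rightarrow> (s, s') \<in> E | Inr (q, N) \<Rightarrow> s \<in> N)
    | Inr (p, M) \<Rightarrow> (case \<sigma> of Inl s' \<Rightarrow> s' \<in> M | Inr (q, N) \<Rightarrow> p \<noteq> q))"
    for \<tau> \<sigma> :: "'a + bool \<times> 'a set"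
  define H where "H = {(u, w). (u, w) \<notin> E \<and> (u \<in> A \<and> w \<in> B \<or> u \<in> B \<and> w \<in> A)}"
  define T where "T = S <+> (UNIV :: bool set) \<times> Pow S"
  have sy: "(u, w) \<in> E \<longleftrightarrow> (w, u) \<in> E" for u w using assms(1) by (auto simp: sym_def)
  have finS: "finite S" using assms(3) V(1) by simp
  have "card T \<le> m"
    using m finS by (simp add: T_def card_Plus card_cartesian_product card_Pow)
  moreover have "finite T" using finS by (simp add: T_def)
  moreover have "t ` V \<subseteq> T" by (auto simp: t_def T_def)
  ultimately show ?thesis
  proof (intro cw_construct_flip[OF assms(1-4), where t=t and T=T and H=H and f=f])
    show "H \<subseteq> V \<times> V" using V(1) by (auto simp: H_def)
    show "sym H" using sy by (auto simp: H_def intro!: symI)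
    show "card (H `` {u}) \<le> 2" if u: "u \<in> V" for u
    proof -
      consider "u \<in> S" | "u \<in> A" | "u \<in> B" using u V(1) by blast
      then show ?thesis
      proof cases
        case 1
        then have "H `` {u} = {}" using V by (auto simp: H_def)
        then show ?thesis by simp
      next
        case 2
        then have "H `` {u} = B - E `` {u}" using V by (auto simp: H_def)
        then show ?thesis using A 2 by simp
      next
        case 3
        then have "H `` {u} = A - E `` {u}" using V by (auto simp: H_def)
        then show ?thesis using B 3 by simp
      qed
    qed
    fix u w assume uw: "u \<in> V" "w \<in> V" "u \<noteq> w"
    show "(u, w) \<in> E \<longleftrightarrow> (f (t u) (t w) \<noteq> ((u, w) \<in> H))"
    proof (cases "u \<in> S \<or> w \<in> S")
      case True
      then have "(u, w) \<notin> H" using V by (auto simp: H_def)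
      moreover have "f (t u) (t w) \<longleftrightarrow> (u, w) \<in> E"
        using True by (auto simp: f_def t_def sy[of w u])
      ultimately show ?thesis by blast
    next
      case False
      then have "f (t u) (t w) \<longleftrightarrow> (u \<in> A) \<noteq> (w \<in> A)" by (simp add: f_def t_def)
      moreover have "u \<in> A \<or> u \<in> B" "w \<in> A \<or> w \<in> B" using uw V(1) False by blast+
      ultimately show ?thesis
        using assms(9,10) V(4) unfolding H_def independent_in_def by blast
    qed
  qed
qed

text \<open>The constant is \<open>(11 + 2 * 2 ^ 11) + 3\<close>, from the bound 11 on the exceptional set.\<close>

lemma cw_construct_triangle_claw_free:
  assumes "triangle_claw_free E V" "V \<noteq> {}"
  shows "\<exists>lab. cw_construct 4110 (induce E V) lab"
proof -
  interpret triangle_claw_free E V by fact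
  have "\<exists>lab. cw_construct (4107 + 3) (induce E V) lab"
  proof (cases "\<exists>v \<in> V. 15 \<le> card (E `` {v} \<inter> V)")
    case True
    then obtain v where "v \<in> V" "15 \<le> card (E `` {v} \<inter> V)" by blast
    from nearly_complete_bipartite[OF this] obtain S A B
      where V: "V = S \<union> A \<union> B" "S \<inter> A = {}" "S \<inter> B = {}" "A \<inter> B = {}" and S: "card S \<le> 11"
        and AB: "independent_in E A" "independent_in E B"
          "\<forall>a \<in> A. card (B - E `` {a}) \<le> 2" "\<forall>b \<in> B. card (A - E `` {b}) \<le> 2"
      by blast
    have "(2::nat) ^ card S \<le> 2 ^ 11" using S by (intro power_increasing) auto
    then have "card S + 2 * 2 ^ card S \<le> 4107" using S by simp
    from cw_construct_nearly_complete_bipartite[OF sym irrefl finite assms(2) V AB this]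
    show ?thesis .
  next
    case False
    then have deg: "card (E `` {v} \<inter> V) \<le> 14" if "v \<in> V" for v using that by fastforce
    show ?thesis
    proof (cases "\<exists>x \<in> V. 3 \<le> card (E `` {x} \<inter> V)")
      case True
      then obtain x where "x \<in> V" "3 \<le> card (E `` {x} \<inter> V)" by blast
      \<comment> \<open>Here 61 = 5 + 4 * 14. With every vertex as its own type, \<open>f\<close> is
        exact and \<open>H\<close> is empty.\<close>
      from few_vertices[OF this deg] have "card V \<le> 61" by simp
      then show ?thesis
        using cw_construct_flip[OF sym irrefl finite assms(2), where t="\<lambda>v. v" and T=V and H="{}"
          and f="\<lambda>u v. (u, v) \<in> E" and m=4107] finite
        by (auto simp: sym_def)
    next
      case False
      then have deg2: "card (E `` {v} \<inter> V) \<le> 2" if "v \<in> V" for v using that by fastforce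
      show ?thesis
      \<comment> \<open>One type and no predicted edge: the sparse graph \<open>H\<close> is the
        given graph itself.\<close>
      proof (rule cw_construct_flip[OF sym irrefl finite assms(2), where t="\<lambda>v. ()" and T=UNIV
          and H="E \<inter> V \<times> V" and f="\<lambda>u v. False" and m=4107])
        show "sym (E \<inter> V \<times> V)" using adj_commute by (auto intro!: symI)
        show "card ((E \<inter> V \<times> V) `` {u}) \<le> 2" if "u \<in> V" for u
        proof -
          have "(E \<inter> V \<times> V) `` {u} = E `` {u} \<inter> V" using that by blast
          then show ?thesis using deg2[OF that] by simp
        qed
      qed auto
    qed
  qed
  then show ?thesis by simp
qed


section \<open>Paw-free graphs\<close>

text \<open>
  Here, as in \<open>claw_3P1_free_on\<close>, the adjacencies force the vertices to be distinct.
\<close>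

definition paw_free_on :: "'a rel \<Rightarrow> 'a set \<Rightarrow> bool" where
  "paw_free_on E V \<longleftrightarrow>
     (\<forall>a \<in> V. \<forall>b \<in> V. \<forall>c \<in> V. \<forall>d \<in> V. (a, b) \<in> E \<longrightarrow> (b, c) \<in> E \<longrightarrow> (a, c) \<in> E \<longrightarrow>
        (d, a) \<in> E \<longrightarrow> (d, b) \<in> E \<or> (d, c) \<in> E)"

text \<open>Olariu's theorem in local form: the conclusion says that non-adjacency is transitive, so
  the graph is complete multipartite. Connectivity is expressed by \<open>conn\<close> through sets
  closed under adjacency, and is applied once to the vertices in triangles and once to the ends of
  undominated edges.\<close>

lemma paw_free_on_edge_dominating:
  assumes "sym E" and paw: "paw_free_on E V"
    and conn: "\<And>X. X \<subseteq> V \<Longrightarrow> X \<noteq> {} \<Longrightarrow> (\<forall>u \<in> X. \<forall>v \<in> V. (u, v) \<in> E \<longrightarrow> v \<in> X) \<Longrightarrow> X = V"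
    and tri: "\<not> triangle_free_on E V"
    and V: "a \<in> V" "b \<in> V" "c \<in> V" and ab: "(a, b) \<in> E"
  shows "(c, a) \<in> E \<or> (c, b) \<in> E"
proof -
  have sy: "(u, v) \<in> E \<Longrightarrow> (v, u) \<in> E" for u v using assms(1) by (auto simp: sym_def)
  have paw': "(d, x) \<in> E \<Longrightarrow> (x, y) \<in> E \<Longrightarrow> (y, z) \<in> E \<Longrightarrow> (x, z) \<in> E \<Longrightarrow> (d, y) \<in> E \<or> (d, z) \<in> E"
    if "d \<in> V" "x \<in> V" "y \<in> V" "z \<in> V" for d x y z
    using paw that unfolding paw_free_on_def by blast
  \<comment> \<open>The vertices lying in a triangle. A neighbour of such a vertex is adjacent to a
    second vertex of the triangle by paw-freeness, so the connecting edge lies in a triangle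
    too.\<close>
  define T where "T = {u \<in> V. \<exists>p \<in> V. \<exists>q \<in> V. (u, p) \<in> E \<and> (p, q) \<in> E \<and> (u, q) \<in> E}"
  have step: "\<exists>e \<in> V. (u, e) \<in> E \<and> (w, e) \<in> E" if u: "u \<in> T" and w: "w \<in> V" "(u, w) \<in> E" for u w
  proof -
    from u obtain p q where pq: "u \<in> V" "p \<in> V" "q \<in> V" "(u, p) \<in> E" "(p, q) \<in> E" "(u, q) \<in> E"
      by (auto simp: T_def)
    from paw'[OF w(1) pq(1,2,3) sy[OF w(2)] pq(4,5,6)] pq show ?thesis by blast
  qed
  have "T = V"
  proof (rule conn)
    show "T \<noteq> {}" using tri by (auto simp: T_def triangle_free_on_def)
    show "\<forall>u \<in> T. \<forall>v \<in> V. (u, v) \<in> E \<longrightarrow> v \<in> T"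
    proof (intro ballI impI)
      fix u w assume uw: "u \<in> T" "w \<in> V" "(u, w) \<in> E"
      from step[OF this] obtain e where "e \<in> V" "(u, e) \<in> E" "(w, e) \<in> E" by blast
      then show "w \<in> T" using uw sy[OF uw(3)] by (auto simp: T_def)
    qed
  qed (auto simp: T_def)
  then have in_triangle: "\<exists>e \<in> V. (u, e) \<in> E \<and> (w, e) \<in> E" if "u \<in> V" "w \<in> V" "(u, w) \<in> E" for u w
    using step that by blast
  \<comment> \<open>An edge undominated by \<open>c\<close> would propagate along adjacency and so reach \<open>c\<close> itself.\<close>
  define W where "W = {a \<in> V. \<exists>b \<in> V. (a, b) \<in> E \<and> (c, a) \<notin> E \<and> (c, b) \<notin> E}"
  have closed: "d \<in> W" if a: "a \<in> W" and d: "d \<in> V" "(a, d) \<in> E" for a d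
  proof (cases "(c, d) \<in> E")
    case False
    then show ?thesis using a d sy[OF d(2)] by (auto simp: W_def)
  next
    case True
    from a obtain b where b: "a \<in> V" "b \<in> V" "(a, b) \<in> E" "(c, a) \<notin> E" "(c, b) \<notin> E"
      by (auto simp: W_def)
    \<comment> \<open>This case is impossible. In the triangle \<open>a\<close>, \<open>d\<close>,
      \<open>e\<close> the vertex \<open>c\<close> is adjacent to \<open>d\<close>, hence to
      \<open>e\<close>; and \<open>b\<close> is adjacent to \<open>d\<close> or \<open>e\<close>,
      which forms a triangle with \<open>a\<close> and \<open>b\<close> whose only vertex adjacent
      to \<open>c\<close> is that one: a paw.\<close>
    from in_triangle[OF b(1) d] obtain e where e: "e \<in> V" "(a, e) \<in> E" "(d, e) \<in> E" by blast
    have ce: "(c, e) \<in> E"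
      using paw'[OF V(3) d(1) b(1) e(1) True sy[OF d(2)] e(2,3)] b(4) by blast
    from paw'[OF b(2,1) d(1) e(1) sy[OF b(3)] d(2) e(3,2)]
    have False
    proof
      assume "(b, d) \<in> E"
      from paw'[OF V(3) d(1) b(1,2) True sy[OF d(2)] b(3) sy[OF this]] b(4,5) show False by blast
    next
      assume "(b, e) \<in> E"
      from paw'[OF V(3) e(1) b(1,2) ce sy[OF e(2)] b(3) sy[OF this]] b(4,5) show False by blast
    qed
    then show ?thesis ..
  qed
  have "c \<notin> W" by (auto simp: W_def)
  have "W = {}"
  proof (rule ccontr)
    assume "W \<noteq> {}"
    then have "W = V" using closed by (intro conn) (auto simp: W_def)
    then show False using \<open>c \<notin> W\<close> V(3) by blast
  qed
  then show ?thesis using V ab by (auto simp: W_def)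
qed

section \<open>Closure under disjoint unions and complete joins\<close>

lemma cw_construct_label_less: "cw_construct k G lab \<Longrightarrow> v \<in> pverts G \<Longrightarrow> lab v < k"
  by (induction rule: cw_construct.induct) auto

lemma cw_construct_const_label:
  assumes "cw_construct k G lab" "i < k"
  shows "\<exists>lab. cw_construct k G lab \<and> (\<forall>v \<in> pverts G. lab v = i)"
proof -
  have "cw_construct k G (\<lambda>v. if lab v \<in> {..<k} - {i} then i else lab v)"
    using assms by (intro cw_construct_relabels[where \<rho>="\<lambda>_. i"]) auto
  then show ?thesis using cw_construct_label_less[OF assms(1)] by fastforce
qed

lemma cw_construct_disjoint:
  assumes "cw_construct k (induce E X) lab" "cw_construct k (induce E Y) lab'" "X \<inter> Y = {}"
    and "\<forall>x \<in> X. \<forall>y \<in> Y. (x, y) \<notin> E \<and> (y, x) \<notin> E"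
  shows "\<exists>lab. cw_construct k (induce E (X \<union> Y)) lab"
proof -
  have "E \<inter> (X \<union> Y) \<times> (X \<union> Y) = E \<inter> X \<times> X \<union> E \<inter> Y \<times> Y" using assms(4) by blast
  then show ?thesis
    using union[OF assms(1,2)] assms(3) by (auto simp: induce_def)
qed

text \<open>Once both sides are finished, their labels can be collapsed to 0 and 1, so a single join
  suffices and \<open>k\<close> does not grow.\<close>

lemma cw_construct_complete_join:
  assumes "cw_construct k (induce E X) lX" "cw_construct k (induce E Y) lY" "X \<inter> Y = {}" "2 \<le> k"
    and "\<forall>x \<in> X. \<forall>y \<in> Y. (x, y) \<in> E \<and> (y, x) \<in> E"
  shows "\<exists>lab. cw_construct k (induce E (X \<union> Y)) lab"
proof -
  obtain l where l: "cw_construct k (induce E X) l" "\<forall>v \<in> X. l v = 0"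
    using cw_construct_const_label[OF assms(1), of 0] assms(4) by (auto simp: induce_def)
  obtain l' where l': "cw_construct k (induce E Y) l'" "\<forall>v \<in> Y. l' v = 1"
    using cw_construct_const_label[OF assms(2), of 1] assms(4) by (auto simp: induce_def)
  let ?l = "\<lambda>v. if v \<in> X then l v else l' v"
  have "cw_construct k \<lparr> pverts = X \<union> Y, parcs = E \<inter> X \<times> X \<union> E \<inter> Y \<times> Y \<rparr> ?l"
    using union[OF l(1) l'(1)] assms(3) by (simp add: induce_def)
  from join[OF this, of 0 1] assms(4)
  have *: "cw_construct k \<lparr> pverts = X \<union> Y, parcs = E \<inter> X \<times> X \<union> E \<inter> Y \<times> Y \<union>
    {(u, v). u \<in> X \<union> Y \<and> v \<in> X \<union> Y \<and> (?l u = 0 \<and> ?l v = 1 \<or> ?l u = 1 \<and> ?l v = 0)} \<rparr> ?l"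
    by simp
  have lX: "u \<in> X \<Longrightarrow> ?l u = 0" and lY: "u \<in> Y \<Longrightarrow> ?l u = 1" for u
    using l(2) l'(2) assms(3) by auto
  have "{(u, v). u \<in> X \<union> Y \<and> v \<in> X \<union> Y \<and> (?l u = 0 \<and> ?l v = 1 \<or> ?l u = 1 \<and> ?l v = 0)} =
      X \<times> Y \<union> Y \<times> X" (is "?L = ?R")
  proof (intro subset_antisym subrelI)
    fix u v assume "(u, v) \<in> ?L"
    then have uv: "u \<in> X \<or> u \<in> Y" "v \<in> X \<or> v \<in> Y" "?l u \<noteq> ?l v" by auto
    have "\<not> (u \<in> X \<and> v \<in> X)" "\<not> (u \<in> Y \<and> v \<in> Y)" using uv(3) lX lY by metis+
    then show "(u, v) \<in> ?R" using uv(1,2) by blast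
  next
    fix u v assume "(u, v) \<in> ?R"
    then show "(u, v) \<in> ?L" using lX lY by fastforce
  qed
  moreover have "E \<inter> X \<times> X \<union> E \<inter> Y \<times> Y \<union> (X \<times> Y \<union> Y \<times> X) = E \<inter> (X \<union> Y) \<times> (X \<union> Y)"
    using assms(5) by blast
  ultimately have "cw_construct k (induce E (X \<union> Y)) ?l" using * by (simp add: induce_def)
  then show ?thesis by (intro exI[of _ ?l])
qed

text \<open>Both conditions pass to subsets, so a disconnected graph splits into a union and a
  connected one with a triangle into a complete join, both of smaller graphs; only connected
  triangle-free graphs need the direct construction.\<close>

lemma cw_construct_paw_claw_free:
  assumes "finite V" "V \<noteq> {}" "sym E" "irrefl E" "paw_free_on E V" "claw_3P1_free_on E V"
  shows "\<exists>lab. cw_construct 4110 (induce E V) lab"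
  using assms
proof (induction V rule: finite_psubset_induct)
  case (psubset V)
  have sy: "(u, v) \<in> E \<longleftrightarrow> (v, u) \<in> E" for u v using psubset.prems(2) by (auto simp: sym_def)
  have IH: "\<exists>lab. cw_construct 4110 (induce E X) lab" if X: "X \<subset> V" "X \<noteq> {}" for X
  proof (rule psubset.IH[OF X psubset.prems(2,3)])
    show "paw_free_on E X"
      using psubset.prems(4) X(1) unfolding paw_free_on_def by (meson psubsetD)
    have "X \<subseteq> V" using X(1) by blast
    then show "claw_3P1_free_on E X"
      using psubset.prems(5) unfolding claw_3P1_free_on_def by (meson subset_trans subsetD)
  qed
  show ?case
  proof (cases "\<exists>X \<subset> V. X \<noteq> {} \<and> (\<forall>u \<in> X. \<forall>v \<in> V. (u, v) \<in> E \<longrightarrow> v \<in> X)")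
    case True
    then obtain X where X: "X \<subset> V" "X \<noteq> {}" "\<forall>u \<in> X. \<forall>v \<in> V. (u, v) \<in> E \<longrightarrow> v \<in> X" by blast
    then have Y: "V - X \<subset> V" "V - X \<noteq> {}" by blast+
    from IH[OF X(1,2)] IH[OF Y] obtain l l' where
      l: "cw_construct 4110 (induce E X) l" "cw_construct 4110 (induce E (V - X)) l'" by blast
    have "X \<union> (V - X) = V" using X(1) by blast
    moreover have "\<forall>x \<in> X. \<forall>y \<in> V - X. (x, y) \<notin> E \<and> (y, x) \<notin> E"
      using X(3) sy by blast
    ultimately show ?thesis using cw_construct_disjoint[OF l] by auto
  next
    case conn: False
    show ?thesis
    proof (cases "triangle_free_on E V")
      case True
      then have "triangle_claw_free E V"
        using psubset by unfold_locales
      then show ?thesis using psubset.prems(1) by (rule cw_construct_triangle_claw_free)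
    next
      case False
      then obtain a a' where a: "a \<in> V" "a' \<in> V" "(a, a') \<in> E"
        by (auto simp: triangle_free_on_def)
      have dom: "(z, x) \<in> E \<or> (z, y) \<in> E" if "x \<in> V" "y \<in> V" "z \<in> V" "(x, y) \<in> E" for x y z
        by (rule paw_free_on_edge_dominating[OF psubset.prems(2,4) _ False that]) (use conn in blast)
      \<comment> \<open>\<open>?X\<close> is the part of the complete multipartite graph that
        contains \<open>a\<close>; by \<open>dom\<close>, each edge from \<open>a\<close> to
        \<open>?Y\<close> forces its end in \<open>?Y\<close> to be adjacent to all of
        \<open>?X\<close>.\<close>
      let ?X = "V - E `` {a}" and ?Y = "V \<inter> E `` {a}"
      have "(a, a) \<notin> E" using psubset.prems(3) by (auto simp: irrefl_def)
      then have X: "?X \<subset> V" "?X \<noteq> {}" and Y: "?Y \<subset> V" "?Y \<noteq> {}" using a by blast+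
      from IH[OF X] IH[OF Y] obtain l l' where
        l: "cw_construct 4110 (induce E ?X) l" "cw_construct 4110 (induce E ?Y) l'" by blast
      have complete: "\<forall>x \<in> ?X. \<forall>y \<in> ?Y. (x, y) \<in> E \<and> (y, x) \<in> E"
      proof (intro ballI)
        fix x y assume xy: "x \<in> ?X" "y \<in> ?Y"
        then have "(x, a) \<in> E \<or> (x, y) \<in> E" using a by (intro dom) auto
        moreover have "(x, a) \<notin> E" using xy(1) sy by blast
        ultimately show "(x, y) \<in> E \<and> (y, x) \<in> E" using sy by blast
      qed
      have "?X \<inter> ?Y = {}" and V: "?X \<union> ?Y = V" by blast+
      from cw_construct_complete_join[OF l this(1) _ complete] show ?thesis unfolding V by simp
    qed
  qed
qed

section \<open>Forbidden induced subgraphs in terms of adjacency\<close>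

text \<open>The image of \<open>f\<close> induces a subgraph on which the inverse of
  \<open>f\<close> is an isomorphism to \<open>H\<close>; afterwards only an explicit embedding has
  to be given.\<close>

lemma induced_freeD:
  assumes free: "induced_free H G" and G: "pair_graph G" and H: "pair_graph H"
    and f: "inj_on f (pverts H)" "f ` pverts H \<subseteq> pverts G"
    and arcs: "\<And>u v. u \<in> pverts H \<Longrightarrow> v \<in> pverts H \<Longrightarrow> (f u, f v) \<in> parcs G \<longleftrightarrow> (u, v) \<in> parcs H"
  shows False
proof -
  let ?X = "f ` pverts H"
  let ?K = "induce (parcs G) ?X"
  let ?g = "the_inv_into (pverts H) f"
  have g: "?g (f u) = u" if "u \<in> pverts H" for u
    using f(1) that by (rule the_inv_into_f_f)
  have HV: "parcs H \<subseteq> pverts H \<times> pverts H" using H by (auto simp: pair_graph_iff)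
  have "pair_graph ?K"
    using G H f(2) by (auto simp: pair_graph_iff induce_def)
  then interpret K: pair_graph ?K .
  interpret G: pair_graph G by fact
  have "induced_subgraph (with_proj ?K) (with_proj G)"
    unfolding induced_subgraph_def subgraph_def compatible_def
    using f(2) K.wf_digraph_axioms G.wf_digraph_axioms by (auto simp: induce_def)
  moreover have "digraph_iso (with_proj ?K) (with_proj H)"
  proof -
    let ?h = "\<lparr> iso_verts = ?g, iso_arcs = map_prod ?g ?g, iso_head = snd, iso_tail = fst \<rparr>"
    have inj: "inj_on ?g ?X" by (rule inj_on_the_inv_into[OF f(1)])
    have "inj_on (map_prod ?g ?g) (parcs ?K)"
      by (rule inj_on_subset[OF map_prod_inj_on[OF inj inj]]) (auto simp: induce_def)
    then have "pre_digraph.digraph_isomorphism (with_proj ?K) ?h"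
      unfolding pre_digraph.digraph_isomorphism_def
      using K.wf_digraph_axioms inj by (simp add: induce_def)
    moreover have "with_proj H = app_iso ?h (with_proj ?K)"
    proof -
      have "pverts H = ?g ` ?X" using g by force
      moreover have "parcs H = map_prod ?g ?g ` (parcs G \<inter> ?X \<times> ?X)"
      proof (intro subset_antisym subrelI)
        fix u v assume uv: "(u, v) \<in> parcs H"
        then have "u \<in> pverts H" "v \<in> pverts H" using HV by auto
        then have "(f u, f v) \<in> parcs G \<inter> ?X \<times> ?X" "(u, v) = map_prod ?g ?g (f u, f v)"
          using arcs uv g by auto
        then show "(u, v) \<in> map_prod ?g ?g ` (parcs G \<inter> ?X \<times> ?X)" by blast
      next
        fix x y assume "(x, y) \<in> map_prod ?g ?g ` (parcs G \<inter> ?X \<times> ?X)"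
        then obtain u v where "u \<in> pverts H" "v \<in> pverts H" "(f u, f v) \<in> parcs G"
          "x = ?g (f u)" "y = ?g (f v)" by auto
        then show "(x, y) \<in> parcs H" using arcs g by auto
      qed
      ultimately show ?thesis by (simp add: app_iso_def with_proj_def induce_def)
    qed
    ultimately show ?thesis unfolding digraph_iso_def by blast
  qed
  ultimately show False using free unfolding induced_free_def by blast
qed

lemma paw_free_on_if_induced_free:
  assumes G: "pair_graph G"
    and free: "induced_free (graph_compl (disj_union (path_graph 1) (path_graph 3))) G"
  shows "paw_free_on (parcs G) (pverts G)"
  unfolding paw_free_on_def
proof (intro ballI impI, rule ccontr)
  fix a b c d
  assume V: "a \<in> pverts G" "b \<in> pverts G" "c \<in> pverts G" "d \<in> pverts G"
    and E: "(a, b) \<in> parcs G" "(b, c) \<in> parcs G" "(a, c) \<in> parcs G" "(d, a) \<in> parcs G"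
    and N: "\<not> ((d, b) \<in> parcs G \<or> (d, c) \<in> parcs G)"
  let ?H = "graph_compl (disj_union (path_graph 1) (path_graph 3))"
  have sy: "(u, v) \<in> parcs G \<Longrightarrow> (v, u) \<in> parcs G" and ir: "(u, u) \<notin> parcs G" for u v
    using G by (auto simp: pair_graph_iff)
  have ne: "a \<noteq> b" "b \<noteq> c" "a \<noteq> c" "d \<noteq> a" "d \<noteq> b" "d \<noteq> c" using E N ir sy by blast+
  have N': "(d, b) \<notin> parcs G" "(d, c) \<notin> parcs G" "(b, d) \<notin> parcs G" "(c, d) \<notin> parcs G" using N sy by blast+
  have E': "(b, a) \<in> parcs G" "(c, b) \<in> parcs G" "(c, a) \<in> parcs G" "(a, d) \<in> parcs G" using E sy by blast+
  \<comment> \<open>In the complement, the vertex of \<open>path_graph 1\<close> becomes the centre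
    \<open>a\<close> of the paw, the middle vertex of \<open>path_graph 3\<close> the pendant vertex
    \<open>d\<close>, and its two ends the remaining triangle vertices.\<close>
  define f :: "nat + nat \<Rightarrow> 'a" where
    "f = (\<lambda>x. case x of Inl _ \<Rightarrow> a | Inr i \<Rightarrow> if i = 0 then b else if i = 1 then d else c)"
  have H: "pverts ?H = {Inl 0, Inr 0, Inr 1, Inr 2}"
    by (auto simp: graph_compl_def disj_union_def path_graph_def)
  have HE: "(u, v) \<in> parcs ?H \<longleftrightarrow> u \<in> pverts ?H \<and> v \<in> pverts ?H \<and> u \<noteq> v \<and>
      (u, v) \<notin> {(Inr 0, Inr 1), (Inr 1, Inr 0), (Inr 1, Inr 2), (Inr 2, Inr 1)}" for u v
    by (auto simp: graph_compl_def disj_union_def path_graph_def less_Suc_eq eval_nat_numeral)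
  show False
  proof (rule induced_freeD[OF free G])
    show "pair_graph ?H"
      by (intro pair_graph_graph_compl pair_graph_disj_union pair_graph_path_graph)
    show "inj_on f (pverts ?H)" unfolding H using ne by (simp add: f_def inj_on_def)
    show "f ` pverts ?H \<subseteq> pverts G" unfolding H using V by (simp add: f_def)
    fix u v assume "u \<in> pverts ?H" "v \<in> pverts ?H"
    then show "(f u, f v) \<in> parcs G \<longleftrightarrow> (u, v) \<in> parcs ?H"
      unfolding HE H insert_iff empty_iff
      by (elim disjE FalseE) (simp_all add: f_def E E' N' ir)
  qed
qed

lemma claw_3P1_free_on_if_induced_free:
  assumes G: "pair_graph G" and free: "induced_free (disj_union claw (copies 3 (path_graph 1))) G"
  shows "claw_3P1_free_on (parcs G) (pverts G)"
  unfolding claw_3P1_free_on_def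
proof (intro notI, elim exE conjE)
  fix x T I
  assume V: "x \<in> pverts G" "T \<subseteq> pverts G" "I \<subseteq> pverts G" and card: "card T = 3" "card I = 3"
    and T: "T \<subseteq> parcs G `` {x}" and I: "I \<inter> parcs G `` {x} = {}"
    and ind: "independent_in (parcs G) (T \<union> I)"
  let ?H = "disj_union claw (copies 3 (path_graph 1))"
  have sy: "(u, v) \<in> parcs G \<Longrightarrow> (v, u) \<in> parcs G" and ir: "(u, u) \<notin> parcs G" for u v
    using G by (auto simp: pair_graph_iff)
  have fin: "finite T" "finite I" using card card.infinite by fastforce+
  \<comment> \<open>The leaves are numbered from 1, since 0 is the centre of
    \<open>claw\<close>.\<close>
  obtain g where g: "bij_betw g {1..3::nat} T"
    using finite_same_card_bij[of "{1..3::nat}" T] fin card by auto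
  obtain h where h: "bij_betw h {..<3::nat} I"
    using finite_same_card_bij[of "{..<3::nat}" I] fin card by auto
  define f :: "nat + nat \<times> nat \<Rightarrow> 'a" where
    "f = (\<lambda>y. case y of Inl i \<Rightarrow> if i = 0 then x else g i | Inr (i, _) \<Rightarrow> h i)"
  have H: "u \<in> pverts ?H \<longleftrightarrow>
      u = Inl 0 \<or> (\<exists>i. u = Inl i \<and> i \<noteq> 0 \<and> i \<le> 3) \<or> (\<exists>i. u = Inr (i, 0) \<and> i < 3)" for u
    by (auto simp: disj_union_def claw_def star_graph_def copies_def path_graph_def)
  have HE: "(u, v) \<in> parcs ?H \<longleftrightarrow>
      (\<exists>i. (u = Inl 0 \<and> v = Inl i \<or> u = Inl i \<and> v = Inl 0) \<and> i \<noteq> 0 \<and> i \<le> 3)" for u v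
    by (auto simp: disj_union_def claw_def star_graph_def copies_def path_graph_def)
  have gT: "g i \<in> T" if "i \<noteq> 0" "i \<le> 3" for i
    using bij_betwE[OF g] that by auto
  have hI: "h i \<in> I" if "i < 3" for i using bij_betwE[OF h] that by auto
  have g_inj: "g i = g j \<longleftrightarrow> i = j" if "i \<noteq> 0" "i \<le> 3" "j \<noteq> 0" "j \<le> 3" for i j
    using g that by (auto simp: bij_betw_def inj_on_def)
  have h_inj: "h i = h j \<longleftrightarrow> i = j" if "i < 3" "j < 3" for i j
    using h that by (auto simp: bij_betw_def inj_on_def)
  have TI: "T \<inter> I = {}" using T I by blast
  have xT: "x \<notin> T" using T ir by blast
  \<comment> \<open>If \<open>x\<close> were in \<open>I\<close>, an edge from \<open>x\<close> to
    \<open>T\<close> would contradict the independence of \<open>T \<union> I\<close>.\<close>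
  have "T \<noteq> {}" using card by auto
  then have xI: "x \<notin> I" using T ind unfolding independent_in_def by blast
  have xg: "(x, y) \<in> parcs G" "(y, x) \<in> parcs G" if "y \<in> T" for y using T that sy by blast+
  have xh: "(x, y) \<notin> parcs G" "(y, x) \<notin> parcs G" if "y \<in> I" for y using I that sy by blast+
  have ind': "(y, z) \<notin> parcs G" if "y \<in> T \<union> I" "z \<in> T \<union> I" for y z
    using ind that unfolding independent_in_def by blast
  show False
  proof (rule induced_freeD[OF free G])
    show "pair_graph ?H"
      by (intro pair_graph_disj_union pair_graph_claw pair_graph_copies pair_graph_path_graph)
    have f: "f (Inl 0) = x" "\<And>i. i \<noteq> 0 \<Longrightarrow> f (Inl i) = g i" "\<And>i. f (Inr (i, 0)) = h i"
      by (simp_all add: f_def)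
    show "f ` pverts ?H \<subseteq> pverts G"
    proof (rule image_subsetI)
      fix u assume "u \<in> pverts ?H"
      then show "f u \<in> pverts G" unfolding H using V gT hI f by (elim disjE exE conjE) auto
    qed
    show "inj_on f (pverts ?H)"
    proof (rule inj_onI)
      have gx: "g i \<noteq> x" "x \<noteq> g i" if "i \<noteq> 0" "i \<le> 3" for i using gT[OF that] xT by auto
      have hx: "h i \<noteq> x" "x \<noteq> h i" if "i < 3" for i using hI[OF that] xI by auto
      have gh: "g i \<noteq> h j" "h j \<noteq> g i" if "i \<noteq> 0" "i \<le> 3" "j < 3" for i j
        using gT[OF that(1,2)] hI[OF that(3)] TI by auto
      fix u v assume "u \<in> pverts ?H" "v \<in> pverts ?H" and eq: "f u = f v"
      then show "u = v"
        unfolding H by (elim disjE exE conjE) (simp_all add: f gx hx gh g_inj h_inj)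
    qed
    fix u v assume "u \<in> pverts ?H" "v \<in> pverts ?H"
    then show "(f u, f v) \<in> parcs G \<longleftrightarrow> (u, v) \<in> parcs ?H"
      unfolding H HE by (elim disjE exE conjE) (simp_all add: f ir xg xh ind' gT hI)
  qed
qed

section \<open>From constructions to bounded clique-width\<close>

lemma cw_construct_pverts_nonempty: "cw_construct k G lab \<Longrightarrow> pverts G \<noteq> {}"
  by (induction rule: cw_construct.induct) auto

theorem theorem2:
  shows "bounded_clique_width
    {G :: 'a pair_pre_digraph. pair_graph G \<and>
       induced_free (graph_compl (disj_union (path_graph 1) (path_graph 3))) G \<and>
       induced_free (disj_union claw (copies 3 (path_graph 1))) G}"
  unfolding bounded_clique_width_def
  \<comment> \<open>\<open>Inf {}\<close> is the clique-width of the empty graph, whatever its value on \<open>nat\<close>.\<close>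
proof (intro exI[of _ "max 4110 (Inf {})"] ballI, elim CollectE conjE)
  fix G :: "'a pair_pre_digraph"
  assume G: "pair_graph G"
    and paw: "induced_free (graph_compl (disj_union (path_graph 1) (path_graph 3))) G"
    and claw: "induced_free (disj_union claw (copies 3 (path_graph 1))) G"
  show "clique_width G \<le> max 4110 (Inf {})"
  proof (cases "pverts G = {}")
    case True
    then have "{k. \<exists>lab. cw_construct k G lab} = {}"
      using cw_construct_pverts_nonempty by blast
    then show ?thesis unfolding clique_width_def by (simp only: max.cobounded2)
  next
    case False
    have "finite (pverts G)" "sym (parcs G)" "irrefl (parcs G)"
      using G by (auto simp: pair_graph_iff sym_def irrefl_def)
    from cw_construct_paw_claw_free[OF this(1) False this(2,3)
        paw_free_on_if_induced_free[OF G paw] claw_3P1_free_on_if_induced_free[OF G claw]]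
    obtain lab where "cw_construct 4110 (induce (parcs G) (pverts G)) lab" by blast
    moreover have "parcs G \<inter> pverts G \<times> pverts G = parcs G"
      using G by (auto simp: pair_graph_iff)
    then have "induce (parcs G) (pverts G) = G" by (cases G) (simp add: induce_def)
    ultimately have "\<exists>lab. cw_construct 4110 G lab" by auto
    then have "clique_width G \<le> 4110" unfolding clique_width_def by (intro cInf_lower) auto
    then show ?thesis by simp
  qed
qed

end
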